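(* Let $E$ be a finite dimensional ceer. Then for every $n\in\mathbb N$, $H\not\leq E^{n+}$.
   Context: A ceer is an equivalence relation on $\mathbb N$ c.e. as a subset of $\mathbb N^2$; $R_1\leq R_2$ means there is a total computable $f$ with $xR_1y\Leftrightarrow f(x)R_2f(y)$. A ceer $R$ is $n$-dimensional ($n>0$) if there are pairwise disjoint c.e. sets $A_1,\dots,A_n$ with $xRy\Leftrightarrow x=y\lor\exists i\leq n\,(x,y\in A_i)$; finite dimensional means $n$-dimensional for some $n>0$. With $\varphi_e$ the standard enumeration of partial computable functions, $xHy\Leftrightarrow x=y\lor\varphi_x(x)\!\downarrow\,=\varphi_y(y)\!\downarrow$. The saturation jump $E^+$ of a ceer $E$ is the equivalence relation on finite subsets of $\mathbb N$ (identified with $\mathbb N$ via a fixed computable bijection) given by $xE^+y\Leftrightarrow [x]_E=[y]_E$, where $[X]_E=\{y:\exists x\in X\,(xEy)\}$; $E^{0+}=E$, $E^{(n+1)+}=(E^{n+})^+$. *)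

theory Defs
  imports Main "HOL-Library.Nat_Bijection" "HOL-Library.Disjoint_Sets"
begin

text \<open>
  Partial computable functions are presented as unary functions over the Cantor pairing
  \<^const>\<open>prod_encode\<close>; \<open>k\<close>-ary functions are unary functions of iterated pairs. Since the
  pairing is a bijection, \<open>Tup Fst Snd\<close> is the identity function.
\<close>

datatype prog =
    Zero | Succ | Fst | Snd
  | Tup prog prog
  | Comp prog prog
  | PRec prog prog
  | Mu prog

text \<open>
  \<open>PRec f g\<close> maps \<open>\<langle>a, 0\<rangle>\<close> to \<open>f a\<close> and \<open>\<langle>a, k + 1\<rangle>\<close> to \<open>g \<langle>a, \<langle>k, r\<rangle>\<rangle>\<close>, where \<open>r\<close> is the value
  at \<open>\<langle>a, k\<rangle>\<close>. The search \<open>Mu f\<close> is unbounded minimisation in the usual partial sense: it diverges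
  if \<open>f\<close> diverges before the first zero.
\<close>

primrec sem :: "prog \<Rightarrow> nat \<Rightarrow> nat option" where
  "sem Zero = (\<lambda>x. Some 0)"
| "sem Succ = (\<lambda>x. Some (Suc x))"
| "sem Fst = (\<lambda>x. Some (fst (prod_decode x)))"
| "sem Snd = (\<lambda>x. Some (snd (prod_decode x)))"
| "sem (Tup f g) =
    (\<lambda>x. Option.bind (sem f x) (\<lambda>a. Option.bind (sem g x) (\<lambda>b. Some (prod_encode (a, b)))))"
| "sem (Comp f g) = (\<lambda>x. Option.bind (sem g x) (sem f))"
| "sem (PRec f g) =
    (\<lambda>x. case prod_decode x of (a, n) \<Rightarrow>
      rec_nat (sem f a)
        (\<lambda>k v. Option.bind v (\<lambda>r. sem g (prod_encode (a, prod_encode (k, r))))) n)"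
| "sem (Mu f) =
    (\<lambda>x. if \<exists>n. sem f (prod_encode (x, n)) = Some 0 \<and> (\<forall>m<n. sem f (prod_encode (x, m)) \<noteq> None)
         then Some (LEAST n. sem f (prod_encode (x, n)) = Some 0)
         else None)"

text \<open>The Goedel numbering is an effective bijection between programs and numbers.\<close>

primrec prog_encode :: "prog \<Rightarrow> nat" where
  "prog_encode Zero = 0"
| "prog_encode Succ = 1"
| "prog_encode Fst = 2"
| "prog_encode Snd = 3"
| "prog_encode (Tup f g) = 4 * prod_encode (prog_encode f, prog_encode g) + 4"
| "prog_encode (Comp f g) = 4 * prod_encode (prog_encode f, prog_encode g) + 5"
| "prog_encode (PRec f g) = 4 * prod_encode (prog_encode f, prog_encode g) + 6"
| "prog_encode (Mu f) = 4 * prog_encode f + 7"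

lemma inj_prog_encode: "inj prog_encode"
proof (rule injI)
  fix p q
  show "prog_encode p = prog_encode q \<Longrightarrow> p = q"
  proof (induction p arbitrary: q)
    case Zero then show ?case by (cases q) auto
  next
    case Succ then show ?case by (cases q) auto
  next
    case Fst then show ?case by (cases q) auto
  next
    case Snd then show ?case by (cases q) auto
  next
    case (Tup f g) then show ?case by (cases q) (simp_all, presburger+)
  next
    case (Comp f g) then show ?case by (cases q) (simp_all, presburger+)
  next
    case (PRec f g) then show ?case by (cases q) (simp_all, presburger+)
  next
    case (Mu f) then show ?case by (cases q) (simp_all, presburger+)
  qed
qed

lemma surj_prog_encode: "surj prog_encode"
proof -
  have "\<exists>p. prog_encode p = e" for e
  proof (induction e rule: less_induct)
    case (less e)
    show ?case
    proof (cases "e < 4")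
      case True
      then have "e = 0 \<or> e = 1 \<or> e = 2 \<or> e = 3" by auto
      then show ?thesis
        by (metis prog_encode.simps(1-4))
    next
      case False
      define m where "m = (e - 4) div 4"
      obtain a b where ab: "m = prod_encode (a, b)"
        by (metis prod_decode_inverse surj_pair)
      have "m < e" using False by (simp add: m_def)
      moreover have "a \<le> m" "b \<le> m"
        by (simp_all add: ab le_prod_encode_1 le_prod_encode_2)
      ultimately obtain p q r where
        "prog_encode p = a" "prog_encode q = b" "prog_encode r = m"
        by (meson less le_less_trans)
      moreover have "e = 4 * m + 4 \<or> e = 4 * m + 5 \<or> e = 4 * m + 6 \<or> e = 4 * m + 7"
        using False unfolding m_def by presburger
      ultimately show ?thesis
        unfolding ab by (metis prog_encode.simps(5-8))
    qed
  qed
  then show ?thesis by (metis surjI surj_def)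
qed

lemma bij_prog_encode: "bij prog_encode"
  using inj_prog_encode surj_prog_encode by (rule bijI)

definition phi :: "nat \<Rightarrow> nat \<Rightarrow> nat option" where
  "phi e = sem (inv prog_encode e)"

definition computable :: "(nat \<Rightarrow> nat) \<Rightarrow> bool" where
  "computable f \<longleftrightarrow> (\<exists>e. \<forall>x. phi e x = Some (f x))"

definition ce :: "nat set \<Rightarrow> bool" where
  "ce A \<longleftrightarrow> (\<exists>e. A = {x. phi e x \<noteq> None})"

definition ceer :: "(nat \<times> nat) set \<Rightarrow> bool" where
  "ceer R \<longleftrightarrow> equiv UNIV R \<and> ce (prod_encode ` R)"

definition reducible :: "(nat \<times> nat) set \<Rightarrow> (nat \<times> nat) set \<Rightarrow> bool" where
  "reducible R S \<longleftrightarrow> (\<exists>f. computable f \<and> (\<forall>x y. (x, y) \<in> R \<longleftrightarrow> (f x, f y) \<in> S))"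

definition dimensional :: "nat \<Rightarrow> (nat \<times> nat) set \<Rightarrow> bool" where
  "dimensional n R \<longleftrightarrow> n > 0 \<and> ceer R \<and>
    (\<exists>A. (\<forall>i\<in>{1..n}. ce (A i)) \<and> disjoint_family_on A {1..n} \<and>
      (\<forall>x y. (x, y) \<in> R \<longleftrightarrow> x = y \<or> (\<exists>i\<in>{1..n}. x \<in> A i \<and> y \<in> A i)))"

definition finite_dimensional :: "(nat \<times> nat) set \<Rightarrow> bool" where
  "finite_dimensional R \<longleftrightarrow> (\<exists>n>0. dimensional n R)"

definition halting_rel :: "(nat \<times> nat) set" where
  "halting_rel = {(x, y). x = y \<or> (\<exists>v. phi x x = Some v \<and> phi y y = Some v)}"

text \<open>
  Finite sets are coded by \<^const>\<open>set_encode\<close> (\<open>D \<mapsto> \<Sum>i\<in>D. 2^i\<close>), whose inverse \<^const>\<open>set_decode\<close>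
  maps the numbers bijectively onto the finite sets of numbers. The saturation of \<open>X\<close> under \<open>E\<close> is
  the relational image \<open>E `` X\<close>.
\<close>

definition sat_jump :: "(nat \<times> nat) set \<Rightarrow> (nat \<times> nat) set" where
  "sat_jump E = {(x, y). E `` set_decode x = E `` set_decode y}"

definition iter_sat_jump :: "nat \<Rightarrow> (nat \<times> nat) set \<Rightarrow> (nat \<times> nat) set" where
  "iter_sat_jump n E = (sat_jump ^^ n) E"

end

theory Submission imports Defs begin

text \<open>
  Call \<open>a\<close> isolated if its \<open>E\<close>-class is a singleton. Unfolding a number \<open>n\<close> times as a code of a finite
  set gives a finite support in the natural numbers, and numbers equivalent under the \<open>n\<close>-th jump have
  the same isolated points in their supports. Given a reduction \<open>f\<close> of \<^const>\<open>halting_rel\<close>, the set of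
  \<open>x\<close> such that a fixed isolated \<open>a\<close> is in the support of \<open>f x\<close> is decidable. The sets
  \<open>K\<^sub>v = {x. phi x x = Some v}\<close> are pairwise recursively inseparable, so \<open>a\<close> belongs to the supports of
  all the \<open>f x\<close> with \<open>x\<close> in some \<open>K\<^sub>v\<close>, or to none of them. Hence these supports all have the same finite
  set \<open>F\<close> of isolated points. As there are only finitely many classes without isolated points, the
  \<open>n\<close>-th jump has only finitely many classes with such a support, but the \<open>K\<^sub>v\<close> have infinitely many
  inequivalent images.
\<close>

section \<open>Computable functions\<close>

lemma phi_prog_encode [simp]: "phi (prog_encode p) = sem p"
  by (simp add: phi_def inj_prog_encode)

lemma computable_iff_sem: "computable f \<longleftrightarrow> (\<exists>p. \<forall>x. sem p x = Some (f x))"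
  unfolding computable_def by (metis phi_def phi_prog_encode)

lemma computable_Suc: "computable f \<Longrightarrow> computable (\<lambda>x. Suc (f x))"
  unfolding computable_iff_sem by (metis bind.bind_lunit sem.simps(2,6))

lemma computable_comp: "computable f \<Longrightarrow> computable g \<Longrightarrow> computable (\<lambda>x. f (g x))"
  unfolding computable_iff_sem by (metis bind.bind_lunit sem.simps(6))

lemma computable_pair:
  "computable f \<Longrightarrow> computable g \<Longrightarrow> computable (\<lambda>x. prod_encode (f x, g x))"
  unfolding computable_iff_sem by (metis bind.bind_lunit sem.simps(5))

lemma computable_fst: "computable f \<Longrightarrow> computable (\<lambda>x. fst (prod_decode (f x)))"
  by (rule computable_comp) (auto simp: computable_iff_sem intro: exI[of _ Fst])

lemma computable_snd: "computable f \<Longrightarrow> computable (\<lambda>x. snd (prod_decode (f x)))"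
  by (rule computable_comp) (auto simp: computable_iff_sem intro: exI[of _ Snd])

lemma computable_id: "computable (\<lambda>x. x)"
  by (auto simp: computable_iff_sem intro!: exI[of _ "Tup Fst Snd"])

lemma computable_const: "computable (\<lambda>_. c)"
proof (induction c)
  case 0
  show ?case by (auto simp: computable_iff_sem intro: exI[of _ Zero])
qed (rule computable_Suc)

text \<open>The hypothesis on \<open>s\<close> follows the nested pairs by which \<open>PRec\<close>
  passes parameter, counter and previous value to its second program.\<close>

lemma computable_rec_nat:
  assumes b: "computable b" and n: "computable n"
    and s: "computable (\<lambda>u. s (fst (prod_decode u)) (fst (prod_decode (snd (prod_decode u))))
              (snd (prod_decode (snd (prod_decode u)))))"
  shows "computable (\<lambda>x. rec_nat (b x) (s x) (n x))"
proof -
  obtain p q where p: "\<And>x. sem p x = Some (b x)"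
    and q: "\<And>u. sem q u = Some (s (fst (prod_decode u)) (fst (prod_decode (snd (prod_decode u))))
              (snd (prod_decode (snd (prod_decode u)))))"
    using b s unfolding computable_iff_sem by blast
  have rec: "rec_nat (sem p a) (\<lambda>k v. Option.bind v (\<lambda>r. sem q (prod_encode (a, prod_encode (k, r))))) m
      = Some (rec_nat (b a) (s a) m)" for a m
    by (induction m) (simp_all add: p q)
  have "computable (\<lambda>u. rec_nat (b (fst (prod_decode u))) (s (fst (prod_decode u))) (snd (prod_decode u)))"
    unfolding computable_iff_sem
    by (rule exI[of _ "PRec p q"]) (simp add: rec split: prod.split)
  from computable_comp[OF this computable_pair[OF computable_id n]] show ?thesis
    by simp
qed

lemmas computable_intros =
  computable_id computable_const computable_Suc computable_pair computable_fst computable_snd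

lemma computable_if_zero:
  assumes "computable c" "computable f" "computable g"
  shows "computable (\<lambda>x. if c x = 0 then f x else g x)"
proof -
  have eq: "(if c x = 0 then f x else g x) = rec_nat (f x) (\<lambda>_ _. g x) (c x)" for x
    by (cases "c x") simp_all
  show ?thesis
    unfolding eq
    by (intro computable_rec_nat computable_comp[OF assms(3)] assms(1,2) computable_intros)
qed

section \<open>Decidable predicates\<close>

definition decidable :: "(nat \<Rightarrow> bool) \<Rightarrow> bool" where
  "decidable P \<longleftrightarrow> computable (\<lambda>x. of_bool (P x))"

lemma decidable_comp: "decidable P \<Longrightarrow> computable f \<Longrightarrow> decidable (\<lambda>x. P (f x))"
  unfolding decidable_def by (rule computable_comp)

lemma computable_if:
  assumes "decidable P" "computable f" "computable g"
  shows "computable (\<lambda>x. if P x then f x else g x)"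
proof -
  have eq: "(if P x then f x else g x) = (if of_bool (P x) = (0::nat) then g x else f x)" for x
    by simp
  show ?thesis
    unfolding eq using assms by (intro computable_if_zero) (simp_all add: decidable_def)
qed

lemma decidable_conj:
  assumes "decidable P" "decidable Q"
  shows "decidable (\<lambda>x. P x \<and> Q x)"
proof -
  have eq: "of_bool (P x \<and> Q x) = (if P x then of_bool (Q x) else 0 :: nat)" for x
    by simp
  show ?thesis
    unfolding decidable_def eq
    by (intro computable_if assms(1) assms(2)[unfolded decidable_def] computable_const)
qed

lemma decidable_not:
  assumes "decidable P"
  shows "decidable (\<lambda>x. \<not> P x)"
proof -
  have eq: "of_bool (\<not> P x) = (if P x then 0 else 1 :: nat)" for x
    by simp
  show ?thesis
    unfolding decidable_def eq by (intro computable_if assms computable_const)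
qed

lemma decidable_bex_less:
  assumes "decidable (\<lambda>u. P (fst (prod_decode u)) (snd (prod_decode u)))" "computable n"
  shows "decidable (\<lambda>x. \<exists>i<n x. P x i)"
proof -
  have eq: "of_bool (\<exists>i<m. P x i) = rec_nat 0 (\<lambda>i r. if P x i then 1 else r) m" for x m
  proof (induction m)
    case (Suc m)
    have "(\<exists>i<Suc m. P x i) \<longleftrightarrow> P x m \<or> (\<exists>i<m. P x i)"
      by (auto simp: less_Suc_eq)
    then show ?case by (simp flip: Suc)
  qed simp
  \<comment> \<open>The recursion step reads \<open>x\<close> and \<open>i\<close> from a coded
    triple, so \<open>P\<close> is moved from pairs to that coding.\<close>
  have P: "decidable (\<lambda>u. P (fst (prod_decode u)) (fst (prod_decode (snd (prod_decode u)))))"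
    using decidable_comp[OF assms(1),
        of "\<lambda>u. prod_encode (fst (prod_decode u), fst (prod_decode (snd (prod_decode u))))"]
    by (simp add: computable_intros)
  show ?thesis
    unfolding decidable_def eq
    by (intro computable_rec_nat computable_if P assms(2) computable_intros)
qed

lemma decidable_eq_const: "decidable (\<lambda>x. x = c)"
proof (induction c)
  case 0
  have "computable (\<lambda>x. if x = 0 then 1 else 0)"
    by (intro computable_if_zero computable_intros)
  then show ?case by (simp add: decidable_def of_bool_def)
next
  case (Suc c)
  \<comment> \<open>For positive \<open>x\<close> the last step sees the predecessor of
    \<open>x\<close> and discards the accumulator; the start value 0 handles
    \<open>x = 0\<close>.\<close>
  have "computable (\<lambda>x. rec_nat 0 (\<lambda>k r. of_bool (k = c)) x)"
    by (intro computable_rec_nat computable_comp[OF Suc[unfolded decidable_def]] computable_intros)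
  moreover have "rec_nat 0 (\<lambda>k r. of_bool (k = c)) x = (of_bool (x = Suc c) :: nat)" for x
    by (cases x) simp_all
  ultimately show ?case by (simp add: decidable_def)
qed

lemma decidable_even: "decidable even"
proof -
  have "computable (\<lambda>x. rec_nat 1 (\<lambda>k r. if r = 0 then 1 else 0) x)"
    by (intro computable_rec_nat computable_if_zero computable_intros)
  moreover have "rec_nat 1 (\<lambda>k r. if r = 0 then 1 else 0) x = (of_bool (even x) :: nat)" for x :: nat
    by (induction x) simp_all
  ultimately show ?thesis by (simp add: decidable_def)
qed

lemma computable_div_2: "computable (\<lambda>x. x div 2)"
proof -
  \<comment> \<open>The quotient grows exactly when the counter passes from an odd \<open>k\<close>
    to its successor.\<close>
  have "computable (\<lambda>x. rec_nat 0 (\<lambda>k r. if even k then r else Suc r) x)"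
    by (intro computable_rec_nat computable_if decidable_comp[OF decidable_even] computable_intros)
  moreover have "rec_nat 0 (\<lambda>k r. if even k then r else Suc r) x = x div 2" for x :: nat
    by (induction x) simp_all
  ultimately show ?thesis by simp
qed

text \<open>Membership is oddness of the code after \<open>f x\<close> halvings, and recursion
  iterates the halving.\<close>

lemma decidable_mem_set_decode:
  assumes "computable f" "computable g"
  shows "decidable (\<lambda>x. f x \<in> set_decode (g x))"
proof -
  have eq: "z div 2 ^ i = rec_nat z (\<lambda>k r. r div 2) i" for z i :: nat
    by (induction i) (simp_all add: power_Suc2 div_mult2_eq del: power_Suc)
  have "computable (\<lambda>x. g x div 2 ^ f x)"
    unfolding eq
    by (intro computable_rec_nat computable_comp[OF computable_div_2] assms computable_intros)
  then show ?thesis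
    unfolding set_decode_def
    by (simp add: decidable_not decidable_comp[OF decidable_even])
qed

text \<open>The summand \<open>2 ^ i\<close> of the code already exceeds \<open>i\<close>. This
  turns quantification over a coded set into a bounded search.\<close>

lemma mem_set_decode_less:
  assumes "i \<in> set_decode z"
  shows "i < z"
proof -
  have "2 ^ i \<le> set_encode (set_decode z)"
    unfolding set_encode_def using assms by (intro member_le_sum) auto
  then show ?thesis
    using less_exp[of i] by (simp del: less_exp)
qed

section \<open>Recursive inseparability\<close>

lemma halting_diagonal:
  assumes "computable g"
  obtains e where "phi e e = Some (g e)"
  using assms unfolding computable_def by blast

lemma halting_class_nonempty: "\<exists>x. phi x x = Some v"
  using halting_diagonal[OF computable_const[of v]] by metis

text \<open>A program returning \<open>w\<close> where \<open>P\<close> holds and \<open>v\<close>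
  elsewhere is run on its own index \<open>e\<close>. If \<open>P e\<close> failed, the value would
  be \<open>v\<close>, forcing \<open>P e\<close>; so \<open>P e\<close> holds and the value is
  \<open>w\<close>.\<close>

lemma halting_inseparable:
  assumes "decidable P" and "\<And>x. phi x x = Some v \<Longrightarrow> P x"
  shows "\<exists>x. phi x x = Some w \<and> P x"
proof -
  obtain e where "phi e e = Some (if P e then w else v)"
    using halting_diagonal[OF computable_if[OF assms(1) computable_const computable_const]] .
  with assms(2) show ?thesis
    by (cases "P e") auto
qed

section \<open>Supports\<close>

primrec hsupport :: "nat \<Rightarrow> nat \<Rightarrow> nat set" where
  "hsupport 0 z = {z}"
| "hsupport (Suc n) z = (\<Union>y\<in>set_decode z. hsupport n y)"

lemma finite_hsupport: "finite (hsupport n z)"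
  by (induction n arbitrary: z) auto

lemma decidable_mem_hsupport: "decidable (\<lambda>z. a \<in> hsupport n z)"
proof (induction n)
  case 0
  show ?case using decidable_eq_const[of a] by (simp add: eq_commute)
next
  case (Suc n)
  have eq: "a \<in> hsupport (Suc n) z \<longleftrightarrow> (\<exists>i<z. i \<in> set_decode z \<and> a \<in> hsupport n i)" for z
    using mem_set_decode_less by auto
  show ?case
    unfolding eq
    by (intro decidable_bex_less decidable_conj decidable_mem_set_decode decidable_comp[OF Suc]
        computable_intros)
qed

lemma iter_sat_jump_0 [simp]: "iter_sat_jump 0 E = E"
  by (simp add: iter_sat_jump_def)

lemma iter_sat_jump_Suc [simp]: "iter_sat_jump (Suc n) E = sat_jump (iter_sat_jump n E)"
  by (simp add: iter_sat_jump_def)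

lemma equiv_sat_jump: "equiv UNIV (sat_jump R)"
  by (auto simp: sat_jump_def equiv_def refl_on_def sym_def trans_def)

lemma equiv_iter_sat_jump: "equiv UNIV E \<Longrightarrow> equiv UNIV (iter_sat_jump n E)"
  by (cases n) (simp_all add: equiv_sat_jump)

text \<open>Each member of one coded set is related, one level down, to a member of the other, and
  the induction hypothesis compares their supports.\<close>

lemma hsupport_iter_sat_jump:
  assumes E: "equiv UNIV E" and "(x, y) \<in> iter_sat_jump n E"
  shows "E `` hsupport n x = E `` hsupport n y"
  using assms(2)
proof (induction n arbitrary: x y)
  case 0
  then show ?case using equiv_class_eq[OF E] by simp
next
  case (Suc n)
  let ?R = "iter_sat_jump n E"
  have R: "refl ?R"
    using equiv_iter_sat_jump[OF E] by (simp add: equiv_def)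
  have sub: "E `` hsupport (Suc n) x \<subseteq> E `` hsupport (Suc n) y"
    if "?R `` set_decode x = ?R `` set_decode y" for x y
  proof
    fix b
    assume "b \<in> E `` hsupport (Suc n) x"
    then obtain u where u: "u \<in> set_decode x" "b \<in> E `` hsupport n u"
      by auto
    have "u \<in> ?R `` set_decode x"
      using u(1) R by (auto simp: refl_on_def)
    then have "u \<in> ?R `` set_decode y"
      using that by simp
    then obtain w where w: "w \<in> set_decode y" "(w, u) \<in> ?R"
      by auto
    from Suc.IH[OF w(2)] u(2) have "b \<in> E `` hsupport n w"
      by simp
    with w(1) show "b \<in> E `` hsupport (Suc n) y"
      by auto
  qed
  have "?R `` set_decode x = ?R `` set_decode y"
    using Suc.prems by (simp add: sat_jump_def)
  from sub[OF this] sub[OF this[symmetric]] show ?case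
    by (rule equalityI)
qed

text \<open>Saturation neither adds nor removes an isolated point, since only the point itself is
  related to it.\<close>

lemma isolated_mem_hsupport_iff:
  assumes E: "equiv UNIV E" and "(x, y) \<in> iter_sat_jump n E" and a: "E `` {a} = {a}"
  shows "a \<in> hsupport n x \<longleftrightarrow> a \<in> hsupport n y"
proof -
  have "a \<in> S \<longleftrightarrow> a \<in> E `` S" for S
  proof
    assume "a \<in> S"
    then show "a \<in> E `` S"
      using a by auto
  next
    assume "a \<in> E `` S"
    then obtain b where b: "b \<in> S" "(b, a) \<in> E"
      by auto
    then have "b \<in> E `` {a}"
      using E by (auto simp: equiv_def dest: symD)
    with a b show "a \<in> S"
      by simp
  qed
  then show ?thesis
    using hsupport_iter_sat_jump[OF assms(1,2)] by blast
qed

lemma finite_classes_hsupport: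
  assumes "finite ((\<lambda>z. E `` {z}) ` G)"
  shows "finite ((\<lambda>z. iter_sat_jump n E `` {z}) ` {z. hsupport n z \<subseteq> G})"
proof (induction n)
  case 0
  show ?case using assms by simp
next
  case (Suc n)
  let ?R = "iter_sat_jump n E"
  let ?Q = "(\<lambda>z. ?R `` {z}) ` {z. hsupport n z \<subseteq> G}"
  \<comment> \<open>A saturation is a union of classes from the finite family \<open>?Q\<close>, so
    only finitely many saturations occur.\<close>
  have "(\<lambda>z. ?R `` set_decode z) ` {z. hsupport (Suc n) z \<subseteq> G} \<subseteq> Union ` Pow ?Q"
  proof clarify
    fix z
    assume "hsupport (Suc n) z \<subseteq> G"
    then have "(\<lambda>y. ?R `` {y}) ` set_decode z \<in> Pow ?Q"
      by auto
    moreover have "?R `` set_decode z = \<Union> ((\<lambda>y. ?R `` {y}) ` set_decode z)"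
      by auto
    ultimately show "?R `` set_decode z \<in> Union ` Pow ?Q"
      by (rule rev_image_eqI)
  qed
  then have "finite ((\<lambda>z. ?R `` set_decode z) ` {z. hsupport (Suc n) z \<subseteq> G})"
    by (rule finite_subset) (simp add: Suc)
  \<comment> \<open>A class of the jump is the fibre over a saturation, hence determined by
    it.\<close>
  then have "finite ((\<lambda>C. {w. C = ?R `` set_decode w}) `
      (\<lambda>z. ?R `` set_decode z) ` {z. hsupport (Suc n) z \<subseteq> G})"
    by (rule finite_imageI)
  moreover have "sat_jump ?R `` {z} = {w. ?R `` set_decode z = ?R `` set_decode w}" for z
    by (auto simp: sat_jump_def)
  ultimately show ?case
    by (simp add: image_image del: hsupport.simps)
qed

section \<open>Refuting a reduction of the halting relation\<close>

lemma halting_not_reducible_iter_sat_jump: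
  assumes E: "equiv UNIV E" and fin: "finite ((\<lambda>z. E `` {z}) ` {a. E `` {a} \<noteq> {a}})"
  shows "\<not> reducible halting_rel (iter_sat_jump n E)"
proof
  assume "reducible halting_rel (iter_sat_jump n E)"
  then obtain f where f: "computable f"
    and red: "\<And>x y. (x, y) \<in> halting_rel \<longleftrightarrow> (f x, f y) \<in> iter_sat_jump n E"
    unfolding reducible_def by blast
  let ?N = "{a. E `` {a} \<noteq> {a}}"
  obtain k where k: "\<And>v. phi (k v) (k v) = Some v"
    using halting_class_nonempty by metis
  have same: "a \<in> hsupport n (f x) \<longleftrightarrow> a \<in> hsupport n (f (k v))"
    if "a \<notin> ?N" "phi x x = Some v" for a x v
  proof -
    have "(x, k v) \<in> halting_rel"
      using that(2) k by (simp add: halting_rel_def)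
    then show ?thesis
      using isolated_mem_hsupport_iff[OF E] red that(1) by blast
  qed
  \<comment> \<open>The decidable property of having \<open>a\<close> in the support of the image
    holds throughout the halting class of \<open>v\<close>. Inseparability gives a point of the
    class of \<open>w\<close> with it, and \<open>same\<close> carries it to
    \<open>k w\<close>.\<close>
  have transfer: "a \<in> hsupport n (f (k w))" if "a \<notin> ?N" "a \<in> hsupport n (f (k v))" for a v w
  proof -
    have "a \<in> hsupport n (f x)" if "phi x x = Some v" for x
      using same \<open>a \<notin> ?N\<close> that \<open>a \<in> hsupport n (f (k v))\<close> by blast
    then obtain x where "phi x x = Some w" "a \<in> hsupport n (f x)"
      using halting_inseparable[OF decidable_comp[OF decidable_mem_hsupport f]] by metis
    then show ?thesis
      using same \<open>a \<notin> ?N\<close> by blast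
  qed
  \<comment> \<open>By \<open>transfer\<close>, isolated points in the support of any
    \<open>f (k v)\<close> already occur for \<open>k 0\<close>; all other points lie in
    \<open>?N\<close>.\<close>
  let ?G = "hsupport n (f (k 0)) \<union> ?N"
  have "finite ((\<lambda>z. E `` {z}) ` ?G)"
    using fin by (simp add: image_Un finite_hsupport)
  then have "finite ((\<lambda>z. iter_sat_jump n E `` {z}) ` {z. hsupport n z \<subseteq> ?G})"
    by (rule finite_classes_hsupport)
  moreover have "range (\<lambda>v. f (k v)) \<subseteq> {z. hsupport n z \<subseteq> ?G}"
    using transfer by blast
  ultimately have "finite (range (\<lambda>v. iter_sat_jump n E `` {f (k v)}))"
    by (rule_tac finite_subset) auto
  \<comment> \<open>The reduction pulls equal classes back to related \<open>k v\<close> and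
    \<open>k w\<close>, whose diagonal values \<open>v\<close> and \<open>w\<close> must then
    agree.\<close>
  moreover have "inj (\<lambda>v. iter_sat_jump n E `` {f (k v)})"
  proof (rule injI)
    fix v w
    assume "iter_sat_jump n E `` {f (k v)} = iter_sat_jump n E `` {f (k w)}"
    then have "(k v, k w) \<in> halting_rel"
      using red eq_equiv_class[OF _ equiv_iter_sat_jump[OF E]] by simp
    then have "phi (k v) (k v) = phi (k w) (k w)"
      by (auto simp: halting_rel_def)
    then show "v = w"
      by (simp add: k)
  qed
  ultimately show False
    using finite_imageD infinite_UNIV_nat by metis
qed

lemma finite_dimensional_nonsingleton_classes:
  assumes "finite_dimensional E"
  shows "finite ((\<lambda>z. E `` {z}) ` {a. E `` {a} \<noteq> {a}})"
proof -
  obtain m where "dimensional m E"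
    using assms unfolding finite_dimensional_def by blast
  then obtain A where disj: "disjoint_family_on A {1..m}"
    and E: "\<And>x y. (x, y) \<in> E \<longleftrightarrow> x = y \<or> (\<exists>i\<in>{1..m}. x \<in> A i \<and> y \<in> A i)"
    unfolding dimensional_def by blast
  have "(\<lambda>z. E `` {z}) ` {a. E `` {a} \<noteq> {a}} \<subseteq> A ` {1..m}"
  proof clarify
    fix a
    assume "E `` {a} \<noteq> {a}"
    moreover have "(a, a) \<in> E"
      by (simp add: E)
    ultimately obtain x where "(a, x) \<in> E" "x \<noteq> a"
      by blast
    then obtain i where i: "i \<in> {1..m}" "a \<in> A i"
      unfolding E by blast
    \<comment> \<open>Disjointness leaves one index for \<open>a\<close>, so its whole class is
      \<open>A i\<close>.\<close>
    then have "j = i" if "j \<in> {1..m}" "a \<in> A j" for j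
      using that disj unfolding disjoint_family_on_def by blast
    with i have "(a, y) \<in> E \<longleftrightarrow> y \<in> A i" for y
      unfolding E by blast
    then have "E `` {a} = A i"
      by auto
    with i show "E `` {a} \<in> A ` {1..m}"
      by blast
  qed
  then show ?thesis
    by (rule finite_subset) simp
qed

theorem theorem7p9:
  fixes E :: "(nat \<times> nat) set"
  assumes "finite_dimensional E"
  shows "\<forall>n::nat. \<not> reducible halting_rel (iter_sat_jump n E)"
proof
  fix n
  have "equiv UNIV E"
    using assms by (auto simp: finite_dimensional_def dimensional_def ceer_def)
  then show "\<not> reducible halting_rel (iter_sat_jump n E)"
    using finite_dimensional_nonsingleton_classes[OF assms]
    by (rule halting_not_reducible_iter_sat_jump)
qed

end
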